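(* Let $n\ge1$, let $a=v_0<v_1<\dots<v_n=b$, let $\zeta_i\in(v_i,v_{i+1})$ for $0\le i\le n-1$, and let $\varphi(i)\ge 2$ be integers for $0\le i\le n$. Then, for every $0\le i\le n$, the B-spline-like functions $\mathcal{N}_{i,\alpha}$, $|\alpha|=\varphi(i)-1$, associated with the vertex $v_i$ are non-negative on $[a,b]$.
   Context: Put $\zeta_{-1}=v_0$, $\zeta_n=v_n$. $\mathbb{P}_d$ is the space of real polynomials of degree $\le d$. The space $\mathcal{S}^1(\varphi,\overline{\tau}_n)$ consists of all functions $s:[a,b]\to\mathbb{R}$ such that: (i) for each $0\le i\le n$, the restrictions of $s$ to $[\zeta_{i-1},v_i]$ and to $[v_i,\zeta_i]$ (when non-degenerate) are in $\mathbb{P}_{\varphi(i)}$; (ii) $s$ is $\mathcal{C}^{\varphi(i)-1}$ at $v_i$ for $0<i<n$; (iii) $s$ is $\mathcal{C}^1$ at $\zeta_i$ for $0\le i\le n-1$ ("$\mathcal{C}^r$ at a point" means that the derivatives of orders $0,\dots,r$ of the two adjacent polynomial pieces agree there). A function $s\in\mathcal{S}^1(\varphi,\overline{\tau}_n)$ exists and is unique with arbitrarily prescribed values $s^{(j)}(v_i)$, $0\le i\le n$, $0\le j\le\varphi(i)-1$ (one-sided derivatives at $a$, $b$). For a multi-index $\alpha=(\alpha_1,\alpha_2)\in\mathbb{Z}_{\ge0}^2$ with $|\alpha|=\alpha_1+\alpha_2=d$ and an interval $[A,B]$, the Bernstein polynomial is $\mathfrak{B}^d_{\alpha,[A,B]}(v)=\frac{d!}{\alpha_1!\alpha_2!}\frac{(B-v)^{\alpha_1}(v-A)^{\alpha_2}}{(B-A)^d}$.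 For $0\le i\le n$ let $\theta_i=\frac{\varphi(i)-1}{\varphi(i)}$, $S_{i,1}=\theta_i\zeta_{i-1}+(1-\theta_i)v_i$, $S_{i,2}=\theta_i\zeta_i+(1-\theta_i)v_i$, and $S_i=[S_{i,1},S_{i,2}]$ (so $S_{0,1}=v_0$ and $S_{n,2}=v_n$). For $|\alpha|=\varphi(i)-1$ and $0\le j\le\varphi(i)-1$ set $$\gamma_{i,\alpha}^j=\frac{\binom{\varphi(i)}{j}}{\binom{\varphi(i)-1}{j}}\,\theta_i^j\,\bigl(\mathfrak{B}^{\varphi(i)-1}_{\alpha,S_i}\bigr)^{(j)}(v_i).$$ The B-spline-like function $\mathcal{N}_{i,\alpha}$ is the unique element of $\mathcal{S}^1(\varphi,\overline{\tau}_n)$ with $\mathcal{N}_{i,\alpha}^{(j)}(v_i)=\gamma_{i,\alpha}^j$ for $0\le j\le\varphi(i)-1$ and $\mathcal{N}_{i,\alpha}^{(j)}(v_k)=0$ for $k\ne i$, $0\le j\le\varphi(k)-1$. *)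

theory Defs
  imports "HOL-Analysis.Analysis" "HOL-Computational_Algebra.Polynomial"
begin

text \<open>Vertices are \<open>v 0, \<dots>, v n\<close> and split points \<open>\<zeta> 0, \<dots>, \<zeta> (n - 1)\<close>. The two functions below
  give \<open>\<zeta>\<close> at index \<open>i - 1\<close> and at index \<open>i\<close> under the conventions that \<open>\<zeta>\<close> at \<open>-1\<close> is \<open>v 0\<close>
  and \<open>\<zeta>\<close> at \<open>n\<close> is \<open>v n\<close>.\<close>

definition left_knot :: "(nat \<Rightarrow> real) \<Rightarrow> (nat \<Rightarrow> real) \<Rightarrow> nat \<Rightarrow> real" where
  "left_knot v \<zeta> i = (if i = 0 then v 0 else \<zeta> (i - 1))"

definition right_knot :: "nat \<Rightarrow> (nat \<Rightarrow> real) \<Rightarrow> (nat \<Rightarrow> real) \<Rightarrow> nat \<Rightarrow> real" where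
  "right_knot n v \<zeta> i = (if i < n then \<zeta> i else v n)"

definition poly_piece :: "(real \<Rightarrow> real) \<Rightarrow> real \<Rightarrow> real \<Rightarrow> nat \<Rightarrow> real poly \<Rightarrow> bool" where
  "poly_piece s A B d p \<longleftrightarrow> degree p \<le> d \<and> (\<forall>x\<in>{A..B}. s x = poly p x)"

definition agree_to_order :: "nat \<Rightarrow> real \<Rightarrow> real poly \<Rightarrow> real poly \<Rightarrow> bool" where
  "agree_to_order r x p q \<longleftrightarrow>
     (\<forall>j\<le>r. poly ((pderiv ^^ j) p) x = poly ((pderiv ^^ j) q) x)"

text \<open>A function on \<open>[v 0, v n]\<close> is represented extensionally (value \<open>undefined\<close> outside), so that
  equality is equality on the interval. \<open>L i\<close> is the polynomial piece immediately to the left of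
  \<open>v i\<close>, and \<open>R i\<close> the one immediately to the right; \<open>L 0\<close> and \<open>R n\<close> would live on degenerate
  intervals and are unconstrained.\<close>

definition spline_space ::
  "nat \<Rightarrow> (nat \<Rightarrow> real) \<Rightarrow> (nat \<Rightarrow> real) \<Rightarrow> (nat \<Rightarrow> nat) \<Rightarrow> (real \<Rightarrow> real) set" where
  "spline_space n v \<zeta> \<phi> = {s \<in> extensional {v 0..v n}.
     \<exists>L R :: nat \<Rightarrow> real poly.
       (\<forall>i\<le>n. (0 < i \<longrightarrow> poly_piece s (left_knot v \<zeta> i) (v i) (\<phi> i) (L i)) \<and>
              (i < n \<longrightarrow> poly_piece s (v i) (right_knot n v \<zeta> i) (\<phi> i) (R i))) \<and>
       (\<forall>i. 0 < i \<and> i < n \<longrightarrow> agree_to_order (\<phi> i - 1) (v i) (L i) (R i)) \<and>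
       (\<forall>i<n. agree_to_order 1 (\<zeta> i) (R i) (L (i + 1)))}"

text \<open>The derivative of order \<open>j\<close> relative to \<open>S\<close>; for \<open>S = [a, b]\<close> it is one-sided at the
  end points.\<close>

definition higher_deriv_within :: "real set \<Rightarrow> nat \<Rightarrow> (real \<Rightarrow> real) \<Rightarrow> real \<Rightarrow> real" where
  "higher_deriv_within S j f = ((\<lambda>g x. vector_derivative g (at x within S)) ^^ j) f"

definition bernstein_on :: "real \<Rightarrow> real \<Rightarrow> nat \<times> nat \<Rightarrow> real \<Rightarrow> real" where
  "bernstein_on A B \<alpha> x =
     fact (fst \<alpha> + snd \<alpha>) / (fact (fst \<alpha>) * fact (snd \<alpha>)) *
     ((B - x) ^ fst \<alpha> * (x - A) ^ snd \<alpha> / (B - A) ^ (fst \<alpha> + snd \<alpha>))"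

definition theta :: "(nat \<Rightarrow> nat) \<Rightarrow> nat \<Rightarrow> real" where
  "theta \<phi> i = (real (\<phi> i) - 1) / real (\<phi> i)"

definition S_left :: "(nat \<Rightarrow> real) \<Rightarrow> (nat \<Rightarrow> real) \<Rightarrow> (nat \<Rightarrow> nat) \<Rightarrow> nat \<Rightarrow> real" where
  "S_left v \<zeta> \<phi> i = theta \<phi> i * left_knot v \<zeta> i + (1 - theta \<phi> i) * v i"

definition S_right :: "nat \<Rightarrow> (nat \<Rightarrow> real) \<Rightarrow> (nat \<Rightarrow> real) \<Rightarrow> (nat \<Rightarrow> nat) \<Rightarrow> nat \<Rightarrow> real" where
  "S_right n v \<zeta> \<phi> i = theta \<phi> i * right_knot n v \<zeta> i + (1 - theta \<phi> i) * v i"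

definition gamma_coeff ::
  "nat \<Rightarrow> (nat \<Rightarrow> real) \<Rightarrow> (nat \<Rightarrow> real) \<Rightarrow> (nat \<Rightarrow> nat) \<Rightarrow> nat \<Rightarrow> nat \<times> nat \<Rightarrow> nat \<Rightarrow> real" where
  "gamma_coeff n v \<zeta> \<phi> i \<alpha> j =
     real (\<phi> i choose j) / real ((\<phi> i - 1) choose j) * theta \<phi> i ^ j *
     (deriv ^^ j) (bernstein_on (S_left v \<zeta> \<phi> i) (S_right n v \<zeta> \<phi> i) \<alpha>) (v i)"

definition bspline_like ::
  "nat \<Rightarrow> (nat \<Rightarrow> real) \<Rightarrow> (nat \<Rightarrow> real) \<Rightarrow> (nat \<Rightarrow> nat) \<Rightarrow> nat \<Rightarrow> nat \<times> nat \<Rightarrow> real \<Rightarrow> real" where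
  "bspline_like n v \<zeta> \<phi> i \<alpha> =
     (THE s. s \<in> spline_space n v \<zeta> \<phi> \<and>
        (\<forall>k\<le>n. \<forall>j\<le>\<phi> k - 1. higher_deriv_within {v 0..v n} j s (v k) =
           (if k = i then gamma_coeff n v \<zeta> \<phi> i \<alpha> j else 0)))"

end

theory Submission
  imports Defs
begin

text \<open>Let \<open>p\<close> be a piece of a B-spline-like function adjacent to the vertex \<open>w\<close>, let \<open>d\<close> be the degree
  and \<open>\<theta>\<close> the ratio attached to \<open>w\<close>, and let \<open>B\<close> be the Bernstein polynomial if \<open>w\<close> is the vertex of the
  function and \<open>0\<close> otherwise. The coefficients \<open>\<gamma>\<close> are such that the Hermite data of \<open>p\<close> at \<open>w\<close> amount
  to the Euler-type identity \<open>d p(x) - (x - w) p'(x) = d B(w + \<theta> (x - w))\<close>, whose right-hand side is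
  non-negative on the piece. Hence \<open>p(w + s h) / s^d\<close> is nonincreasing in \<open>s\<close>, so \<open>p\<close> is non-negative as
  soon as its value at the split point is. At the split point the two pieces share value and slope, and
  eliminating the slope from the two inequalities there shows that the value is non-negative. With
  \<open>B = 0\<close>, the same argument for \<open>p\<close> and \<open>-p\<close> gives uniqueness of Hermite interpolation; existence is
  a 2-by-2 linear system on each interval.\<close>

section \<open>Taylor coefficients and the Euler-type identity\<close>

lemma higher_pderiv_pcompose_linear:
  fixes p :: "real poly"
  shows "(pderiv ^^ j) (p \<circ>\<^sub>p [:v, t:]) = smult (t ^ j) ((pderiv ^^ j) p \<circ>\<^sub>p [:v, t:])"
  by (induction j) (simp_all add: pderiv_smult pderiv_pcompose pderiv_pCons algebra_simps)

text \<open>Taylor's formula at \<open>v\<close> in the variable \<open>y\<close> with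
  \<open>x = v + t * y\<close>; it turns Hermite data into coefficients that can be compared one by
  one.\<close>

lemma coeff_pcompose_linear:
  fixes p :: "real poly"
  shows "coeff (p \<circ>\<^sub>p [:v, t:]) j = t ^ j * poly ((pderiv ^^ j) p) v / fact j"
proof -
  have "fact j * coeff (p \<circ>\<^sub>p [:v, t:]) j = poly ((pderiv ^^ j) (p \<circ>\<^sub>p [:v, t:])) 0"
    using coeff_higher_pderiv[of j "p \<circ>\<^sub>p [:v, t:]" 0]
    by (simp add: poly_0_coeff_0 pochhammer_fact)
  also have "\<dots> = t ^ j * poly ((pderiv ^^ j) p) v"
    by (simp add: higher_pderiv_pcompose_linear poly_pcompose)
  finally show ?thesis
    by (simp add: field_simps)
qed

text \<open>In the variable \<open>y = x - v\<close> the operator on the left multiplies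
  \<open>y^j\<close> by \<open>d - j\<close>. This cancels the denominator in \<open>derivs\<close>,
  so both sides have the same coefficients.\<close>

lemma euler_identity_of_derivs:
  fixes p B :: "real poly"
  assumes deg: "degree p \<le> d" "degree B < d"
    and derivs: "\<And>j. j < d \<Longrightarrow> poly ((pderiv ^^ j) p) v
                   = real d / (real d - real j) * t ^ j * poly ((pderiv ^^ j) B) v"
  shows "real d * poly p x - (x - v) * poly (pderiv p) x = real d * poly B (v + t * (x - v))"
proof -
  define f where "f = p \<circ>\<^sub>p [:v, 1:]"
  have "coeff (smult (real d) f - pCons 0 (pderiv f)) j = coeff (smult (real d) (B \<circ>\<^sub>p [:v, t:])) j" for j
  proof -
    have "coeff (smult (real d) f - pCons 0 (pderiv f)) j = (real d - real j) * coeff f j"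
      by (cases j) (simp_all add: coeff_pderiv algebra_simps)
    also have "\<dots> = real d * coeff (B \<circ>\<^sub>p [:v, t:]) j"
    proof (cases j d rule: linorder_cases)
      case less
      then show ?thesis
        unfolding f_def coeff_pcompose_linear by (simp add: derivs)
    next
      \<comment> \<open>The data leave the coefficient of \<open>y^d\<close> in \<open>p\<close>
        free. The factor \<open>d - j\<close> removes it here, and \<open>B\<close> has no term of
        this degree.\<close>
      case equal
      then have "coeff (B \<circ>\<^sub>p [:v, t:]) j = 0"
        using deg by (intro coeff_eq_0) (auto simp: degree_pcompose)
      then show ?thesis
        using equal by simp
    next
      case greater
      then have "coeff (B \<circ>\<^sub>p [:v, t:]) j = 0" "coeff f j = 0"
        unfolding f_def using deg by (auto intro!: coeff_eq_0 simp: degree_pcompose)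
      then show ?thesis
        by simp
    qed
    finally show ?thesis
      by simp
  qed
  then have "smult (real d) f - pCons 0 (pderiv f) = smult (real d) (B \<circ>\<^sub>p [:v, t:])"
    by (rule poly_eqI)
  then have "poly (smult (real d) f - pCons 0 (pderiv f)) (x - v)
      = poly (smult (real d) (B \<circ>\<^sub>p [:v, t:])) (x - v)"
    by (rule arg_cong)
  then show ?thesis
    by (simp add: f_def poly_pcompose pderiv_pcompose pderiv_pCons algebra_simps)
qed

text \<open>The hypothesis says that \<open>p (v + s * h) / s ^ d\<close> is nonincreasing in \<open>s\<close>.\<close>

lemma poly_nonneg_of_euler_nonneg:
  fixes p :: "real poly"
  assumes "d > 0"
    and euler: "\<And>s. s \<in> {0..1} \<Longrightarrow>
      real d * poly p (v + s * h) - (s * h) * poly (pderiv p) (v + s * h) \<ge> 0"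
    and endpoint: "poly p (v + h) \<ge> 0"
    and "s \<in> {0..1}"
  shows "poly p (v + s * h) \<ge> 0"
proof (cases "s = 0")
  \<comment> \<open>The quotient makes no sense at \<open>s = 0\<close>, but there the Euler
    inequality itself reads \<open>d * p(v) >= 0\<close>.\<close>
  case True
  then show ?thesis
    using euler[of 0] \<open>d > 0\<close> by (simp add: zero_le_mult_iff)
next
  case False
  define F where "F = (\<lambda>s. poly p (v + s * h) / s ^ d)"
  have "F 1 \<le> F s"
  proof (rule DERIV_nonpos_imp_nonincreasing[where f = F and a = s and b = 1])
    show "s \<le> 1"
      using \<open>s \<in> {0..1}\<close> by simp
    fix u assume u: "s \<le> u" "u \<le> 1"
    then have "u > 0"
      using False \<open>s \<in> {0..1}\<close> by auto
    have du: "u ^ d = u * u ^ (d - 1)"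
      using \<open>d > 0\<close> by (simp add: power_eq_if)
    have lin: "((\<lambda>s. v + s * h) has_real_derivative h) (at u)"
      by (auto intro!: derivative_eq_intros)
    have 1: "((\<lambda>s. poly p (v + s * h)) has_real_derivative poly (pderiv p) (v + u * h) * h) (at u)"
      using DERIV_chain'[OF lin poly_DERIV[of p "v + u * h"]] by simp
    have 2: "((\<lambda>s. s ^ d) has_real_derivative real d * u ^ (d - 1)) (at u)"
      by (auto intro!: derivative_eq_intros)
    have "(F has_real_derivative
        (poly (pderiv p) (v + u * h) * h * u ^ d - poly p (v + u * h) * (real d * u ^ (d - 1)))
          / (u ^ d * u ^ d)) (at u)"
      unfolding F_def using \<open>u > 0\<close> by (intro DERIV_divide[OF 1 2]) simp
    \<comment> \<open>The numerator of the quotient rule is \<open>- u^(d-1)\<close> times the Euler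
      expression.\<close>
    moreover have "poly (pderiv p) (v + u * h) * h * u ^ d - poly p (v + u * h) * (real d * u ^ (d - 1))
        = - (u ^ (d - 1) * (real d * poly p (v + u * h) - (u * h) * poly (pderiv p) (v + u * h)))"
      unfolding du by (simp add: algebra_simps)
    moreover have "\<dots> \<le> 0"
      using euler[of u] u \<open>u > 0\<close> by (simp add: mult_nonneg_nonneg)
    ultimately show "\<exists>y. (F has_real_derivative y) (at u) \<and> y \<le> 0"
      by (metis divide_nonpos_nonneg zero_le_square)
  qed
  then have "F s \<ge> 0"
    using endpoint by (simp add: F_def)
  moreover have "s ^ d > 0"
    using False \<open>s \<in> {0..1}\<close> by simp
  ultimately show ?thesis
    by (simp add: F_def zero_le_divide_iff)
qed

section \<open>Positivity of two pieces joined at a split point\<close>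

lemma join_nonneg:
  fixes p q B C :: "real poly"
  assumes "v < z" "z < w" "d > 0" "e > 0"
    and p: "\<And>x. real d * poly p x - (x - v) * poly (pderiv p) x = real d * poly B (v + t * (x - v))"
    and q: "\<And>x. real e * poly q x - (x - w) * poly (pderiv q) x = real e * poly C (w + u * (x - w))"
    and B: "\<And>x. x \<in> {v..z} \<Longrightarrow> poly B (v + t * (x - v)) \<ge> 0"
    and C: "\<And>x. x \<in> {z..w} \<Longrightarrow> poly C (w + u * (x - w)) \<ge> 0"
    and join: "agree_to_order 1 z p q"
  shows "x \<in> {v..z} \<Longrightarrow> poly p x \<ge> 0" "x \<in> {z..w} \<Longrightarrow> poly q x \<ge> 0"
proof -
  have eq: "poly p z = poly q z" "poly (pderiv p) z = poly (pderiv q) z"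
    using join unfolding agree_to_order_def by (auto dest: spec[of _ 0] spec[of _ 1])
  \<comment> \<open>At \<open>z\<close> the common slope appears with the factor
    \<open>z - v > 0\<close> on the left and \<open>z - w < 0\<close> on the right, so it is bounded
    from opposite sides.\<close>
  have "(z - v) * poly (pderiv p) z \<le> real d * poly p z"
    using p[of z] mult_nonneg_nonneg[OF of_nat_0_le_iff B[of z], of d] assms(1) by simp
  then have 1: "(w - z) * ((z - v) * poly (pderiv p) z) \<le> (w - z) * (real d * poly p z)"
    using assms(2) by (intro mult_left_mono) auto
  have "(z - w) * poly (pderiv p) z \<le> real e * poly p z"
    using q[of z] mult_nonneg_nonneg[OF of_nat_0_le_iff C[of z], of e] assms(2) eq by simp
  then have 2: "(z - v) * ((z - w) * poly (pderiv p) z) \<le> (z - v) * (real e * poly p z)"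
    using assms(1) by (intro mult_left_mono) auto
  \<comment> \<open>The weights \<open>w - z\<close> and \<open>z - v\<close> make the two slope
    terms opposite, so they cancel in the sum.\<close>
  have "0 \<le> (real d * (w - z) + real e * (z - v)) * poly p z"
    using 1 2 by (simp add: algebra_simps)
  moreover have "real d * (w - z) + real e * (z - v) > 0"
    using assms(1-4) by (simp add: add_pos_pos)
  ultimately have c: "poly p z \<ge> 0"
    by (simp add: zero_le_mult_iff)
  show "poly p x \<ge> 0" if x: "x \<in> {v..z}"
  proof -
    have "poly p (v + (x - v) / (z - v) * (z - v)) \<ge> 0"
    proof (rule poly_nonneg_of_euler_nonneg[OF \<open>d > 0\<close>])
      fix s :: real assume "s \<in> {0..1}"
      then have "0 \<le> s * (z - v)" "s * (z - v) \<le> z - v"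
        using assms(1) by (simp_all add: mult_left_le_one_le)
      then have "v + s * (z - v) \<in> {v..z}"
        by auto
      from B[OF this] show "0 \<le> real d * poly p (v + s * (z - v)) - s * (z - v) * poly (pderiv p) (v + s * (z - v))"
        using p[of "v + s * (z - v)"] by simp
    qed (use c x assms(1) in \<open>auto simp: field_simps\<close>)
    then show ?thesis
      using assms(1) by simp
  qed
  show "poly q x \<ge> 0" if x: "x \<in> {z..w}"
  proof -
    \<comment> \<open>Now \<open>h = z - w\<close> is negative: \<open>s\<close> runs from the
      vertex \<open>w\<close> back to \<open>z\<close>.\<close>
    have "poly q (w + (x - w) / (z - w) * (z - w)) \<ge> 0"
    proof (rule poly_nonneg_of_euler_nonneg[OF \<open>e > 0\<close>])
      fix s :: real assume "s \<in> {0..1}"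
      then have "0 \<le> s * (w - z)" "s * (w - z) \<le> w - z"
        using assms(2) by (simp_all add: mult_left_le_one_le)
      then have "w + s * (z - w) \<in> {z..w}"
        by (auto simp: algebra_simps)
      from C[OF this] show "0 \<le> real e * poly q (w + s * (z - w)) - s * (z - w) * poly (pderiv q) (w + s * (z - w))"
        using q[of "w + s * (z - w)"] by simp
    qed (use c eq x assms(2) in \<open>auto simp: divide_simps\<close>)
    then show ?thesis
      using assms(2) by simp
  qed
qed

section \<open>Hermite interpolation on one interval\<close>

text \<open>Uniqueness, to be applied to the differences of two interpolants. Zero data make both
  Euler expressions vanish, so \<open>join_nonneg\<close> applies to both signs.\<close>

lemma hermite_join_zero:
  fixes p q :: "real poly"
  assumes "v < z" "z < w" "d > 0" "e > 0" "degree p \<le> d" "degree q \<le> e"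
    and "\<And>j. j < d \<Longrightarrow> poly ((pderiv ^^ j) p) v = 0"
    and "\<And>j. j < e \<Longrightarrow> poly ((pderiv ^^ j) q) w = 0"
    and join: "agree_to_order 1 z p q"
  shows "x \<in> {v..z} \<Longrightarrow> poly p x = 0" "x \<in> {z..w} \<Longrightarrow> poly q x = 0"
proof -
  have p: "real d * poly p x - (x - v) * poly (pderiv p) x = 0" for x
    using euler_identity_of_derivs[of p d 0 v 0] assms by simp
  have q: "real e * poly q x - (x - w) * poly (pderiv q) x = 0" for x
    using euler_identity_of_derivs[of q e 0 w 0] assms by simp
  have join': "agree_to_order 1 z (- p) (- q)"
    using join unfolding agree_to_order_def by (simp add: le_Suc_eq pderiv_minus)
  note pos = join_nonneg[of v z w d e p 0 0 q 0 0, OF assms(1-4) _ _ _ _ join]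
  note neg = join_nonneg[of v z w d e "- p" 0 0 "- q" 0 0, OF assms(1-4) _ _ _ _ join']
  show "poly p x = 0" if "x \<in> {v..z}"
    using pos(1)[OF _ _ _ _ that] neg(1)[OF _ _ _ _ that] p q
    by (simp add: pderiv_minus eq_diff_eq diff_eq_eq)
  show "poly q x = 0" if "x \<in> {z..w}"
    using pos(2)[OF _ _ _ _ that] neg(2)[OF _ _ _ _ that] p q
    by (simp add: pderiv_minus eq_diff_eq diff_eq_eq)
qed

text \<open>The \<open>d\<close> conditions at \<open>v\<close> leave one degree of freedom in
  degree \<open>d\<close>, the multiple \<open>c\<close> of \<open>(x - v)^d\<close>. It is kept as
  a parameter so that the join at the split point can fix it.\<close>

lemma hermite_poly_exists:
  fixes g :: "nat \<Rightarrow> real"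
  obtains T :: "real poly" where
    "\<And>c. degree (T + smult c ([:- v, 1:] ^ d)) \<le> d"
    "\<And>c j. j < d \<Longrightarrow> poly ((pderiv ^^ j) (T + smult c ([:- v, 1:] ^ d))) v = g j"
proof
  define P where "P = (\<Sum>j<d. monom (g j / fact j) j)"
  define T where "T = P \<circ>\<^sub>p [:- v, 1:]"
  have shift: "T + smult c ([:- v, 1:] ^ d) = (P + monom c d) \<circ>\<^sub>p [:- v, 1:]" for c
    unfolding poly_eq_poly_eq_iff[symmetric]
    by (simp add: fun_eq_iff T_def poly_pcompose poly_power poly_monom)
  fix c
  show "degree (T + smult c ([:- v, 1:] ^ d)) \<le> d"
    unfolding shift degree_pcompose P_def
    by (auto intro!: degree_add_le degree_sum_le order_trans[OF degree_monom_le])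
  fix j assume "j < d"
  \<comment> \<open>Shifting back by \<open>v\<close> recovers the Taylor polynomial, whose
    coefficients below \<open>d\<close> are the prescribed ones.\<close>
  have "((P + monom c d) \<circ>\<^sub>p [:- v, 1:]) \<circ>\<^sub>p [:v, 1:] = P + monom c d"
    by (simp flip: pcompose_assoc add: pcompose_pCons)
  then have "poly ((pderiv ^^ j) (T + smult c ([:- v, 1:] ^ d))) v / fact j = coeff (P + monom c d) j"
    unfolding shift using coeff_pcompose_linear[of "(P + monom c d) \<circ>\<^sub>p [:- v, 1:]" v 1 j] by simp
  also have "\<dots> = g j / fact j"
    using \<open>j < d\<close> by (simp add: P_def coeff_sum)
  finally show "poly ((pderiv ^^ j) (T + smult c ([:- v, 1:] ^ d))) v = g j"
    by simp
qed

text \<open>Each side has one free top coefficient, and matching value and slope at \<open>z\<close>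
  gives two linear equations for the two of them.\<close>

lemma hermite_join_exists:
  fixes g g' :: "nat \<Rightarrow> real"
  assumes "v < z" "z < w" "d > 0" "e > 0"
  obtains p q :: "real poly" where
    "degree p \<le> d" "degree q \<le> e"
    "\<And>j. j < d \<Longrightarrow> poly ((pderiv ^^ j) p) v = g j"
    "\<And>j. j < e \<Longrightarrow> poly ((pderiv ^^ j) q) w = g' j"
    "agree_to_order 1 z p q"
proof -
  obtain P :: "real poly" where P:
    "\<And>c. degree (P + smult c ([:- v, 1:] ^ d)) \<le> d"
    "\<And>c j. j < d \<Longrightarrow> poly ((pderiv ^^ j) (P + smult c ([:- v, 1:] ^ d))) v = g j"
    using hermite_poly_exists by blast
  obtain Q :: "real poly" where Q:
    "\<And>c. degree (Q + smult c ([:- w, 1:] ^ e)) \<le> e"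
    "\<And>c j. j < e \<Longrightarrow> poly ((pderiv ^^ j) (Q + smult c ([:- w, 1:] ^ e))) w = g' j"
    using hermite_poly_exists by blast
  \<comment> \<open>Let \<open>X\<close> and \<open>Y\<close> be the values at \<open>z\<close> of
    the two correction terms. The join requires \<open>X - Y = A\<close> and
    \<open>d * X / (z - v) - e * Y / (z - w) = B\<close>; eliminating \<open>X\<close> leaves
    \<open>D * Y = B - d * A / (z - v)\<close>, solvable because \<open>D > 0\<close>.\<close>
  define A where "A = poly Q z - poly P z"
  define B where "B = poly (pderiv Q) z - poly (pderiv P) z"
  define D where "D = real d / (z - v) + real e / (w - z)"
  have "D > 0"
    unfolding D_def using assms by (simp add: add_pos_pos)
  define Y where "Y = (B - real d * A / (z - v)) / D"
  define X where "X = Y + A"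
  have "D * Y = B - real d * A / (z - v)"
    unfolding Y_def using \<open>D > 0\<close> by simp
  then have XY: "real d * X / (z - v) - real e * Y / (z - w) = B"
    unfolding X_def D_def minus_diff_eq[of w z, symmetric] divide_minus_right
    by (simp add: algebra_simps add_divide_distrib)
  define p where "p = P + smult (X / (z - v) ^ d) ([:- v, 1:] ^ d)"
  define q where "q = Q + smult (Y / (z - w) ^ e) ([:- w, 1:] ^ e)"
  have pow: "(z - v) ^ d = (z - v) * (z - v) ^ (d - 1)" "(z - w) ^ e = (z - w) * (z - w) ^ (e - 1)"
    using assms by (simp_all add: power_eq_if)
  have "poly p z = poly P z + X" "poly q z = poly Q z + Y"
    unfolding p_def q_def using assms by (simp_all add: poly_power)
  moreover have "poly (pderiv p) z = poly (pderiv P) z + real d * X / (z - v)"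
    unfolding p_def using assms pow
    by (simp add: pderiv_add pderiv_smult pderiv_power pderiv_pCons poly_power)
  moreover have "poly (pderiv q) z = poly (pderiv Q) z + real e * Y / (z - w)"
    unfolding q_def using assms pow
    by (simp add: pderiv_add pderiv_smult pderiv_power pderiv_pCons poly_power)
  ultimately have "agree_to_order 1 z p q"
    using XY unfolding agree_to_order_def X_def A_def B_def by (auto simp: le_Suc_eq)
  then show thesis
    using that[of p q] P Q unfolding p_def q_def by blast
qed


section \<open>Derivatives of piecewise polynomials relative to an interval\<close>

lemma has_vector_derivative_If_poly:
  fixes p q :: "real poly"
  assumes "poly p c = poly q c" "poly (pderiv p) c = poly (pderiv q) c"
  shows "((\<lambda>x. if x \<le> c then poly p x else poly q x) has_vector_derivative
    (if x \<le> c then poly (pderiv p) x else poly (pderiv q) x)) (at x)"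
proof -
  have poly: "(poly r has_vector_derivative poly (pderiv r) x) (at x within A)" for r :: "real poly" and A
    by (rule has_vector_derivative_at_within)
       (simp flip: has_real_derivative_iff_has_vector_derivative)
  have "((\<lambda>x. if x \<in> {..c} then poly p x else poly q x) has_vector_derivative
    (if x \<in> {..c} then poly (pderiv p) x else poly (pderiv q) x)) (at x within UNIV)"
    by (rule has_vector_derivative_If_within_closures[where T = "{c..}"])
       (use assms in \<open>auto intro: poly\<close>)
  then show ?thesis
    by simp
qed

text \<open>This links the analytic derivatives in the definition of the B-spline-like functions to
  formal derivatives of the pieces. Each differentiation needs the formula on a neighbourhood, hence
  the open set \<open>U\<close>, and one more order of agreement at \<open>c\<close>.\<close>

lemma higher_deriv_within_piecewise:
  assumes "a < b" "open U"
    and s: "\<And>x. x \<in> {a..b} \<inter> U \<Longrightarrow> s x = (if x \<le> c then poly p x else poly q x)"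
    and agree: "agree_to_order m c p q"
    and "j \<le> m" "x \<in> {a..b} \<inter> U"
  shows "higher_deriv_within {a..b} j s x =
    (if x \<le> c then poly ((pderiv ^^ j) p) x else poly ((pderiv ^^ j) q) x)"
  using assms(5,6)
proof (induction j arbitrary: x)
  case 0
  then show ?case
    using s by (simp add: higher_deriv_within_def)
next
  case (Suc j)
  let ?f = "\<lambda>x. if x \<le> c then poly ((pderiv ^^ j) p) x else poly ((pderiv ^^ j) q) x"
  let ?D = "if x \<le> c then poly ((pderiv ^^ Suc j) p) x else poly ((pderiv ^^ Suc j) q) x"
  have "poly ((pderiv ^^ i) p) c = poly ((pderiv ^^ i) q) c" if "i \<le> Suc j" for i
    using agree that \<open>Suc j \<le> m\<close> unfolding agree_to_order_def by auto
  from this[of j] this[of "Suc j"]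
  have "(?f has_vector_derivative ?D) (at x)"
    using has_vector_derivative_If_poly[of "(pderiv ^^ j) p" c "(pderiv ^^ j) q" x]
    by (simp only: funpow.simps o_apply)
  then have "(?f has_vector_derivative ?D) (at x within {a..b})"
    by (rule has_vector_derivative_at_within)
  moreover have "\<forall>\<^sub>F y in nhds x. y \<in> {a..b} \<longrightarrow> higher_deriv_within {a..b} j s y = ?f y"
    by (rule eventually_mono[OF eventually_nhds_in_open[OF \<open>open U\<close>, of x]]) (use Suc in auto)
  ultimately have "(higher_deriv_within {a..b} j s has_vector_derivative ?D) (at x within {a..b})"
    using has_vector_derivative_cong_ev[of "{a..b}" "higher_deriv_within {a..b} j s" ?f x] Suc by auto
  \<comment> \<open>Derivatives relative to a non-degenerate closed interval are unique, also at its
    end points.\<close>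
  then have "vector_derivative (higher_deriv_within {a..b} j s) (at x within {a..b}) = ?D"
    using \<open>a < b\<close> Suc.prems by (intro vector_derivative_within_closed_interval) auto
  then show ?case
    by (simp add: higher_deriv_within_def)
qed

section \<open>Bernstein polynomials and the coefficients \<open>gamma_coeff\<close>\<close>

text \<open>Formal counterpart of \<open>bernstein_on\<close>, giving access to
  \<open>pderiv\<close> and \<open>degree\<close>.\<close>

definition bernstein_poly :: "real \<Rightarrow> real \<Rightarrow> nat \<times> nat \<Rightarrow> real poly" where
  "bernstein_poly A B \<alpha> =
     smult (fact (fst \<alpha> + snd \<alpha>) / (fact (fst \<alpha>) * fact (snd \<alpha>)) / (B - A) ^ (fst \<alpha> + snd \<alpha>))
       ([:B, -1:] ^ fst \<alpha> * [:- A, 1:] ^ snd \<alpha>)"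

lemma poly_bernstein_poly: "poly (bernstein_poly A B \<alpha>) = bernstein_on A B \<alpha>"
  by (simp add: fun_eq_iff bernstein_poly_def bernstein_on_def poly_power)

lemma degree_bernstein_poly: "degree (bernstein_poly A B \<alpha>) \<le> fst \<alpha> + snd \<alpha>"
proof -
  have "degree ([:B, -1:] ^ fst \<alpha>) \<le> fst \<alpha>" "degree ([:- A, 1:] ^ snd \<alpha>) \<le> snd \<alpha>"
    by (simp_all add: degree_power_eq)
  then show ?thesis
    unfolding bernstein_poly_def
    by (intro order_trans[OF degree_smult_le] order_trans[OF degree_mult_le]) simp
qed

lemma bernstein_on_nonneg: "x \<in> {A..B} \<Longrightarrow> 0 \<le> bernstein_on A B \<alpha> x"
  by (auto simp: bernstein_on_def)

lemma higher_deriv_poly: "(deriv ^^ j) (poly p) = poly ((pderiv ^^ j) p)" for p :: "real poly"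
proof (induction j)
  case (Suc j)
  have "deriv (poly q) = poly (pderiv q)" for q :: "real poly"
    by (intro ext DERIV_imp_deriv poly_DERIV)
  then show ?case
    by (simp add: Suc)
qed simp

text \<open>By absorption, \<open>(d - j) * (d choose j) = d * ((d - 1) choose j)\<close>, so the
  ratio of binomials is the factor \<open>d / (d - j)\<close> demanded by
  \<open>euler_identity_of_derivs\<close>.\<close>

lemma gamma_coeff_eq:
  assumes "j < \<phi> i"
  shows "gamma_coeff n v \<zeta> \<phi> i \<alpha> j = real (\<phi> i) / (real (\<phi> i) - real j) * theta \<phi> i ^ j *
    poly ((pderiv ^^ j) (bernstein_poly (S_left v \<zeta> \<phi> i) (S_right n v \<zeta> \<phi> i) \<alpha>)) (v i)"
proof -
  have "(real (\<phi> i) - real j) * real (\<phi> i choose j) = real (\<phi> i) * real ((\<phi> i - 1) choose j)"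
    using binomial_absorb_comp[of "\<phi> i" j] assms
    by (metis less_imp_le of_nat_diff of_nat_mult)
  moreover have "real ((\<phi> i - 1) choose j) > 0"
    using assms by (simp add: zero_less_binomial_iff)
  ultimately have "real (\<phi> i choose j) / real ((\<phi> i - 1) choose j) = real (\<phi> i) / (real (\<phi> i) - real j)"
    using assms by (simp add: field_simps)
  then show ?thesis
    unfolding gamma_coeff_def poly_bernstein_poly[symmetric] higher_deriv_poly by simp
qed

lemma higher_pderiv_diff: "(pderiv ^^ j) (p - q) = (pderiv ^^ j) p - (pderiv ^^ j) q"
  for p q :: "real poly"
  by (induction j) (simp_all add: pderiv_diff)

section \<open>Existence and uniqueness of splines on the whole partition\<close>

locale refined_partition =
  fixes n :: nat and v \<zeta> :: "nat \<Rightarrow> real" and \<phi> :: "nat \<Rightarrow> nat"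
  assumes n_pos: "n \<ge> 1"
    and zeta: "i < n \<Longrightarrow> v i < \<zeta> i" "i < n \<Longrightarrow> \<zeta> i < v (Suc i)"
    and phi: "i \<le> n \<Longrightarrow> \<phi> i \<ge> 2"
begin

lemma v_less_Suc: "i < n \<Longrightarrow> v i < v (Suc i)"
  using zeta[of i] by simp

lemma v_mono: "i \<le> j \<Longrightarrow> j \<le> n \<Longrightarrow> v i \<le> v j"
proof (induction rule: dec_induct)
  case (step m)
  then show ?case
    using v_less_Suc[of m] by simp
qed simp

lemma obtain_interval:
  assumes "x \<in> {v 0..v n}"
  obtains k where "k < n" "x \<in> {v k..v (Suc k)}"
proof -
  define k where "k = (LEAST k. x \<le> v (Suc k))"
  have n: "x \<le> v (Suc (n - 1))"
    using assms n_pos by simp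
  then have "x \<le> v (Suc k)"
    unfolding k_def by (rule LeastI)
  moreover have "k < n"
    using Least_le[of "\<lambda>k. x \<le> v (Suc k)", OF n] n_pos unfolding k_def by simp
  moreover have "v k \<le> x"
    \<comment> \<open>For \<open>k > 0\<close>, minimality excludes \<open>x \<le> v k\<close>; for
      \<open>k = 0\<close> the bound is the left end of the domain.\<close>
    using assms not_less_Least[of "k - 1" "\<lambda>k. x \<le> v (Suc k)"] unfolding k_def[symmetric]
    by (cases k) auto
  ultimately show thesis
    using that by simp
qed

text \<open>The conditions of \<open>spline_space\<close> with the witnesses \<open>L\<close> and
  \<open>R\<close> as arguments.\<close>

definition spline_pieces :: "(real \<Rightarrow> real) \<Rightarrow> (nat \<Rightarrow> real poly) \<Rightarrow> (nat \<Rightarrow> real poly) \<Rightarrow> bool" where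
  "spline_pieces s L R \<longleftrightarrow>
     (\<forall>i\<le>n. (0 < i \<longrightarrow> poly_piece s (left_knot v \<zeta> i) (v i) (\<phi> i) (L i)) \<and>
            (i < n \<longrightarrow> poly_piece s (v i) (right_knot n v \<zeta> i) (\<phi> i) (R i))) \<and>
     (\<forall>i. 0 < i \<and> i < n \<longrightarrow> agree_to_order (\<phi> i - 1) (v i) (L i) (R i)) \<and>
     (\<forall>i<n. agree_to_order 1 (\<zeta> i) (R i) (L (i + 1)))"

lemma spline_space_iff:
  "s \<in> spline_space n v \<zeta> \<phi> \<longleftrightarrow> s \<in> extensional {v 0..v n} \<and> (\<exists>L R. spline_pieces s L R)"
  unfolding spline_space_def spline_pieces_def by simp

definition interpolates :: "(nat \<Rightarrow> nat \<Rightarrow> real) \<Rightarrow> (real \<Rightarrow> real) \<Rightarrow> bool" where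
  "interpolates g s \<longleftrightarrow>
     (\<forall>k\<le>n. \<forall>j\<le>\<phi> k - 1. higher_deriv_within {v 0..v n} j s (v k) = g k j)"

lemma vertex_derivs:
  assumes pieces: "spline_pieces s L R" and "k \<le> n" "j \<le> \<phi> k - 1"
  shows "0 < k \<Longrightarrow> higher_deriv_within {v 0..v n} j s (v k) = poly ((pderiv ^^ j) (L k)) (v k)"
    and "k < n \<Longrightarrow> higher_deriv_within {v 0..v n} j s (v k) = poly ((pderiv ^^ j) (R k)) (v k)"
proof -
  \<comment> \<open>At an end vertex the only adjacent piece serves on both sides, and
    \<open>l\<close> or \<open>r\<close> lies outside the domain; thus every vertex is interior to
    \<open>{l<..<r}\<close>.\<close>
  define p where "p = (if k = 0 then R k else L k)"
  define q where "q = (if k = n then L k else R k)"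
  define l where "l = (if k = 0 then v 0 - 1 else \<zeta> (k - 1))"
  define r where "r = (if k = n then v n + 1 else \<zeta> k)"
  have lr: "l < v k" "v k < r"
    unfolding l_def r_def using \<open>k \<le> n\<close> zeta(2)[of "k - 1"] zeta(1)[of k] by auto
  have L: "s x = poly (L k) x" if "0 < k" "x \<in> {\<zeta> (k - 1)..v k}" for x
    using pieces that \<open>k \<le> n\<close> unfolding spline_pieces_def poly_piece_def left_knot_def by auto
  have R: "s x = poly (R k) x" if "k < n" "x \<in> {v k..\<zeta> k}" for x
    using pieces that unfolding spline_pieces_def poly_piece_def right_knot_def by auto
  have agree: "agree_to_order (\<phi> k - 1) (v k) p q"
    using pieces \<open>k \<le> n\<close> n_pos unfolding spline_pieces_def p_def q_def
    by (auto simp: agree_to_order_def)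
  have vk: "v k \<in> {v 0..v n}"
    using v_mono[of 0 k] v_mono[of k n] \<open>k \<le> n\<close> by simp
  have "higher_deriv_within {v 0..v n} j s (v k)
     = (if v k \<le> v k then poly ((pderiv ^^ j) p) (v k) else poly ((pderiv ^^ j) q) (v k))"
  proof (rule higher_deriv_within_piecewise[OF _ open_greaterThanLessThan[of l r] _ agree \<open>j \<le> \<phi> k - 1\<close>])
    show "v 0 < v n"
      using v_less_Suc[of 0] v_mono[of 1 n] n_pos by simp
    fix x assume "x \<in> {v 0..v n} \<inter> {l<..<r}"
    then show "s x = (if x \<le> v k then poly p x else poly q x)"
      using L[of x] R[of x] \<open>k \<le> n\<close> n_pos unfolding l_def r_def p_def q_def
      by (auto split: if_splits)
  qed (use vk lr in auto)
  then have p: "higher_deriv_within {v 0..v n} j s (v k) = poly ((pderiv ^^ j) p) (v k)"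
    by simp
  also have "\<dots> = poly ((pderiv ^^ j) q) (v k)"
    using agree \<open>j \<le> \<phi> k - 1\<close> unfolding agree_to_order_def by simp
  finally have q: "higher_deriv_within {v 0..v n} j s (v k) = poly ((pderiv ^^ j) q) (v k)" .
  show "higher_deriv_within {v 0..v n} j s (v k) = poly ((pderiv ^^ j) (L k)) (v k)" if "0 < k"
    using p that by (simp add: p_def)
  show "higher_deriv_within {v 0..v n} j s (v k) = poly ((pderiv ^^ j) (R k)) (v k)" if "k < n"
    using q that by (simp add: q_def)
qed

lemma spline_on_interval:
  assumes "s \<in> spline_space n v \<zeta> \<phi>" "interpolates g s" "k < n"
  obtains p q where
    "degree p \<le> \<phi> k" "degree q \<le> \<phi> (Suc k)"
    "\<And>j. j < \<phi> k \<Longrightarrow> poly ((pderiv ^^ j) p) (v k) = g k j"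
    "\<And>j. j < \<phi> (Suc k) \<Longrightarrow> poly ((pderiv ^^ j) q) (v (Suc k)) = g (Suc k) j"
    "agree_to_order 1 (\<zeta> k) p q"
    "\<And>x. x \<in> {v k..\<zeta> k} \<Longrightarrow> s x = poly p x"
    "\<And>x. x \<in> {\<zeta> k..v (Suc k)} \<Longrightarrow> s x = poly q x"
proof -
  obtain L R where pieces: "spline_pieces s L R"
    using assms(1) unfolding spline_space_iff by blast
  then have R: "poly_piece s (v k) (\<zeta> k) (\<phi> k) (R k)"
    and L: "poly_piece s (\<zeta> k) (v (Suc k)) (\<phi> (Suc k)) (L (Suc k))"
    and agree: "agree_to_order 1 (\<zeta> k) (R k) (L (Suc k))"
    using \<open>k < n\<close> unfolding spline_pieces_def left_knot_def right_knot_def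
    by (auto dest: spec[of _ "Suc k"] spec[of _ k])
  show thesis
  proof (rule that)
    show "poly ((pderiv ^^ j) (R k)) (v k) = g k j" if "j < \<phi> k" for j
      using vertex_derivs(2)[OF pieces, of k j] assms(2,3) that unfolding interpolates_def by auto
    show "poly ((pderiv ^^ j) (L (Suc k))) (v (Suc k)) = g (Suc k) j" if "j < \<phi> (Suc k)" for j
      using vertex_derivs(1)[OF pieces, of "Suc k" j] assms(2,3) that unfolding interpolates_def by auto
  qed (use R L agree in \<open>auto simp: poly_piece_def\<close>)
qed

text \<open>The data at the vertices decouple the intervals, so each is solved separately.
  Smoothness at an inner vertex is automatic, since both adjacent pieces carry the same data
  there.\<close>

lemma spline_exists: "\<exists>s \<in> spline_space n v \<zeta> \<phi>. interpolates g s"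
proof -
  have "\<exists>p q. degree p \<le> \<phi> k \<and> degree q \<le> \<phi> (Suc k) \<and>
      (\<forall>j<\<phi> k. poly ((pderiv ^^ j) p) (v k) = g k j) \<and>
      (\<forall>j<\<phi> (Suc k). poly ((pderiv ^^ j) q) (v (Suc k)) = g (Suc k) j) \<and>
      agree_to_order 1 (\<zeta> k) p q" if "k < n" for k
  proof -
    have "\<phi> k > 0" "\<phi> (Suc k) > 0"
      using phi[of k] phi[of "Suc k"] that by auto
    from hermite_join_exists[OF zeta[OF that] this, of "g k" "g (Suc k)"]
    show ?thesis
      by metis
  qed
  then obtain P Q where PQ: "\<And>k. k < n \<Longrightarrow> degree (P k) \<le> \<phi> k \<and> degree (Q k) \<le> \<phi> (Suc k) \<and>
      (\<forall>j<\<phi> k. poly ((pderiv ^^ j) (P k)) (v k) = g k j) \<and>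
      (\<forall>j<\<phi> (Suc k). poly ((pderiv ^^ j) (Q k)) (v (Suc k)) = g (Suc k) j) \<and>
      agree_to_order 1 (\<zeta> k) (P k) (Q k)"
    by metis
  define s where "s = (\<lambda>x\<in>{v 0..v n}. let k = LEAST k. x \<le> v (Suc k) in
    if x \<le> \<zeta> k then poly (P k) x else poly (Q k) x)"
  have s: "s x = (if x \<le> \<zeta> k then poly (P k) x else poly (Q k) x)"
    if k: "k < n" and x: "x \<in> {v k..v (Suc k)}" for k x
  proof -
    have dom: "x \<in> {v 0..v n}"
      using x v_mono[of 0 k] v_mono[of "Suc k" n] k by auto
    \<comment> \<open>The least index is \<open>k\<close> except at a vertex \<open>x = v k\<close>
      with \<open>k > 0\<close>, where it selects the previous interval. There both pieces take the
      value \<open>g k 0\<close>.\<close>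
    show ?thesis
    proof (cases "x = v k \<and> k > 0")
      case False
      have "(LEAST k. x \<le> v (Suc k)) = k"
      proof (rule Least_equality)
        fix m assume m: "x \<le> v (Suc m)"
        show "k \<le> m"
        proof (rule ccontr)
          assume "\<not> k \<le> m"
          then show False
            using m x False v_mono[of "Suc m" k] k by auto
        qed
      qed (use x in simp)
      then show ?thesis
        using dom by (simp add: s_def)
    next
      case True
      then obtain m where m: "k = Suc m"
        by (cases k) auto
      have "(LEAST k. x \<le> v (Suc k)) = m"
      proof (rule Least_equality)
        fix i assume i: "x \<le> v (Suc i)"
        show "m \<le> i"
        proof (rule ccontr)
          assume "\<not> m \<le> i"
          then show False
            using i True m v_mono[of "Suc i" m] v_less_Suc[of m] k by auto
        qed
      qed (use True m in simp)
      then have "s x = poly (Q m) (v k)"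
        using dom True m zeta(2)[of m] k by (simp add: s_def)
      also have "\<dots> = g k 0"
        using PQ[of m] m k phi[of k] by (auto dest!: spec[of _ "0 :: nat"])
      also have "\<dots> = poly (P k) x"
        using PQ[of k] k phi[of k] True by (auto dest!: spec[of _ "0 :: nat"])
      finally show ?thesis
        using True zeta(1)[of k] k by simp
    qed
  qed
  have P: "poly_piece s (v k) (\<zeta> k) (\<phi> k) (P k)" if "k < n" for k
    using s[OF that] PQ[OF that] zeta[OF that] unfolding poly_piece_def by auto
  have Q: "poly_piece s (\<zeta> k) (v (Suc k)) (\<phi> (Suc k)) (Q k)" if "k < n" for k
  proof -
    \<comment> \<open>At the split point itself \<open>s\<close> is defined by \<open>P k\<close>,
      so the right piece needs the join condition.\<close>
    have "poly (P k) (\<zeta> k) = poly (Q k) (\<zeta> k)"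
      using PQ[OF that] unfolding agree_to_order_def by (auto dest: spec[of _ 0])
    then show ?thesis
      using s[OF that] PQ[OF that] zeta[OF that] unfolding poly_piece_def
      by (auto simp: order_le_less)
  qed
  \<comment> \<open>\<open>Q k\<close> lies to the left of \<open>v (Suc k)\<close>, hence the index
    shift; at \<open>i = 0\<close> the truncated value \<open>Q 0\<close> is unconstrained.\<close>
  have pieces: "spline_pieces s (\<lambda>i. Q (i - 1)) P"
    unfolding spline_pieces_def
  proof (intro conjI allI impI)
    fix i assume i: "i \<le> n"
    show "poly_piece s (left_knot v \<zeta> i) (v i) (\<phi> i) (Q (i - 1))" if "0 < i"
      using Q[of "i - 1"] i that by (simp add: left_knot_def)
    show "poly_piece s (v i) (right_knot n v \<zeta> i) (\<phi> i) (P i)" if "i < n"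
      using P[of i] that by (simp add: right_knot_def)
  next
    fix i assume i: "0 < i \<and> i < n"
    then show "agree_to_order (\<phi> i - 1) (v i) (Q (i - 1)) (P i)"
      using PQ[of i] PQ[of "i - 1"] phi[of i] unfolding agree_to_order_def by auto
  next
    fix i assume "i < n"
    then show "agree_to_order 1 (\<zeta> i) (P i) (Q (i + 1 - 1))"
      using PQ by simp
  qed
  then have "s \<in> spline_space n v \<zeta> \<phi>"
    unfolding spline_space_iff by (auto simp: s_def)
  moreover have "interpolates g s"
    unfolding interpolates_def
  proof (intro allI impI)
    fix k j assume k: "k \<le> n" and j: "j \<le> \<phi> k - 1"
    then have "j < \<phi> k"
      using phi[of k] by auto
    show "higher_deriv_within {v 0..v n} j s (v k) = g k j"
    proof (cases "k = n")
      case True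
      then show ?thesis
        using vertex_derivs(1)[OF pieces k j] PQ[of "n - 1"] n_pos \<open>j < \<phi> k\<close> by simp
    next
      case False
      then show ?thesis
        using vertex_derivs(2)[OF pieces k j] PQ[of k] k \<open>j < \<phi> k\<close> by simp
    qed
  qed
  ultimately show ?thesis
    by blast
qed

lemma spline_unique:
  assumes s: "s \<in> spline_space n v \<zeta> \<phi>" "interpolates g s"
    and s': "s' \<in> spline_space n v \<zeta> \<phi>" "interpolates g s'"
  shows "s = s'"
proof (rule extensionalityI)
  show "s \<in> extensional {v 0..v n}" "s' \<in> extensional {v 0..v n}"
    using s s' unfolding spline_space_iff by auto
  fix x assume "x \<in> {v 0..v n}"
  then obtain k where k: "k < n" "x \<in> {v k..v (Suc k)}"
    by (rule obtain_interval)
  have pos: "\<phi> k > 0" "\<phi> (Suc k) > 0"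
    using phi[of k] phi[of "Suc k"] k by auto
  obtain p q where pq:
    "degree p \<le> \<phi> k" "degree q \<le> \<phi> (Suc k)"
    "\<And>j. j < \<phi> k \<Longrightarrow> poly ((pderiv ^^ j) p) (v k) = g k j"
    "\<And>j. j < \<phi> (Suc k) \<Longrightarrow> poly ((pderiv ^^ j) q) (v (Suc k)) = g (Suc k) j"
    "agree_to_order 1 (\<zeta> k) p q"
    "\<And>x. x \<in> {v k..\<zeta> k} \<Longrightarrow> s x = poly p x"
    "\<And>x. x \<in> {\<zeta> k..v (Suc k)} \<Longrightarrow> s x = poly q x"
    using spline_on_interval[OF s k(1)] by blast
  obtain p' q' where pq':
    "degree p' \<le> \<phi> k" "degree q' \<le> \<phi> (Suc k)"
    "\<And>j. j < \<phi> k \<Longrightarrow> poly ((pderiv ^^ j) p') (v k) = g k j"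
    "\<And>j. j < \<phi> (Suc k) \<Longrightarrow> poly ((pderiv ^^ j) q') (v (Suc k)) = g (Suc k) j"
    "agree_to_order 1 (\<zeta> k) p' q'"
    "\<And>x. x \<in> {v k..\<zeta> k} \<Longrightarrow> s' x = poly p' x"
    "\<And>x. x \<in> {\<zeta> k..v (Suc k)} \<Longrightarrow> s' x = poly q' x"
    using spline_on_interval[OF s' k(1)] by blast
  have "agree_to_order 1 (\<zeta> k) (p - p') (q - q')"
    using pq(5) pq'(5) unfolding agree_to_order_def by (simp add: higher_pderiv_diff)
  note zero = hermite_join_zero[OF zeta[OF k(1)] pos
      degree_diff_le[OF pq(1) pq'(1)] degree_diff_le[OF pq(2) pq'(2)] _ _ this, of x]
  have "x \<in> {v k..\<zeta> k} \<or> x \<in> {\<zeta> k..v (Suc k)}"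
    using k by auto
  then show "s x = s' x"
    using zero pq pq' by (auto simp: higher_pderiv_diff)
qed

lemma bspline_like_properties:
  "bspline_like n v \<zeta> \<phi> i \<alpha> \<in> spline_space n v \<zeta> \<phi>"
  "interpolates (\<lambda>k j. if k = i then gamma_coeff n v \<zeta> \<phi> i \<alpha> j else 0) (bspline_like n v \<zeta> \<phi> i \<alpha>)"
proof -
  let ?g = "\<lambda>k j. if k = i then gamma_coeff n v \<zeta> \<phi> i \<alpha> j else 0"
  have "\<exists>!s. s \<in> spline_space n v \<zeta> \<phi> \<and> interpolates ?g s"
    using spline_exists[of ?g] spline_unique[of _ ?g] by blast
  from theI'[OF this]
  show "bspline_like n v \<zeta> \<phi> i \<alpha> \<in> spline_space n v \<zeta> \<phi>"
    "interpolates ?g (bspline_like n v \<zeta> \<phi> i \<alpha>)"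
    unfolding bspline_like_def interpolates_def by blast+
qed

section \<open>Non-negativity of the B-spline-like functions\<close>

text \<open>The contraction towards \<open>v k\<close> with ratio \<open>theta \<phi> k\<close> maps
  the two pieces around \<open>v k\<close> onto \<open>S_k\<close>, the interval where the Bernstein
  polynomials are non-negative.\<close>

lemma bernstein_near_vertex_nonneg:
  assumes "k \<le> n" "x \<in> {left_knot v \<zeta> k..right_knot n v \<zeta> k}"
  shows "0 \<le> poly (bernstein_poly (S_left v \<zeta> \<phi> k) (S_right n v \<zeta> \<phi> k) \<alpha>)
    (v k + theta \<phi> k * (x - v k))"
proof -
  have "theta \<phi> k \<ge> 0"
    using phi[of k] \<open>k \<le> n\<close> by (simp add: theta_def)
  then have "theta \<phi> k * left_knot v \<zeta> k \<le> theta \<phi> k * x"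
    "theta \<phi> k * x \<le> theta \<phi> k * right_knot n v \<zeta> k"
    using assms(2) by (auto intro: mult_left_mono)
  then show ?thesis
    unfolding poly_bernstein_poly
    by (intro bernstein_on_nonneg) (simp add: S_left_def S_right_def algebra_simps)
qed

lemma bspline_like_nonneg:
  assumes \<alpha>: "fst \<alpha> + snd \<alpha> = \<phi> i - 1" and "x \<in> {v 0..v n}"
  shows "0 \<le> bspline_like n v \<zeta> \<phi> i \<alpha> x"
proof -
  let ?s = "bspline_like n v \<zeta> \<phi> i \<alpha>"
  let ?g = "\<lambda>k j. if k = i then gamma_coeff n v \<zeta> \<phi> i \<alpha> j else 0"
  \<comment> \<open>Setting \<open>B\<close> to zero at all other vertices lets one Euler identity
    cover every vertex.\<close>
  define B where "B = (\<lambda>k. if k = i then bernstein_poly (S_left v \<zeta> \<phi> i) (S_right n v \<zeta> \<phi> i) \<alpha> else 0)"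
  obtain k where k: "k < n" "x \<in> {v k..v (Suc k)}"
    using obtain_interval[OF assms(2)] .
  have pos: "\<phi> k > 0" "\<phi> (Suc k) > 0"
    using phi[of k] phi[of "Suc k"] k by auto
  obtain p q where pq:
    "degree p \<le> \<phi> k" "degree q \<le> \<phi> (Suc k)"
    "\<And>j. j < \<phi> k \<Longrightarrow> poly ((pderiv ^^ j) p) (v k) = ?g k j"
    "\<And>j. j < \<phi> (Suc k) \<Longrightarrow> poly ((pderiv ^^ j) q) (v (Suc k)) = ?g (Suc k) j"
    "agree_to_order 1 (\<zeta> k) p q"
    "\<And>x. x \<in> {v k..\<zeta> k} \<Longrightarrow> ?s x = poly p x"
    "\<And>x. x \<in> {\<zeta> k..v (Suc k)} \<Longrightarrow> ?s x = poly q x"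
    using spline_on_interval[OF bspline_like_properties k(1)] by blast
  have g: "?g m j = real (\<phi> m) / (real (\<phi> m) - real j) * theta \<phi> m ^ j * poly ((pderiv ^^ j) (B m)) (v m)"
    if "j < \<phi> m" for m j
    using gamma_coeff_eq[of j \<phi> i n v \<zeta> \<alpha>] that by (auto simp: B_def)
  have deg: "degree (B m) < \<phi> m" if "\<phi> m > 0" for m
    using degree_bernstein_poly[of "S_left v \<zeta> \<phi> i" "S_right n v \<zeta> \<phi> i" \<alpha>] \<alpha> that
    by (auto simp: B_def)
  have B: "0 \<le> poly (B m) (v m + theta \<phi> m * (y - v m))"
    if "m \<le> n" "y \<in> {left_knot v \<zeta> m..right_knot n v \<zeta> m}" for m y
    using bernstein_near_vertex_nonneg[OF that, of \<alpha>] by (auto simp: B_def)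
  have p: "real (\<phi> k) * poly p y - (y - v k) * poly (pderiv p) y
      = real (\<phi> k) * poly (B k) (v k + theta \<phi> k * (y - v k))" for y
    using pq(1) deg[OF pos(1)] by (rule euler_identity_of_derivs) (simp only: pq(3) g)
  have q: "real (\<phi> (Suc k)) * poly q y - (y - v (Suc k)) * poly (pderiv q) y
      = real (\<phi> (Suc k)) * poly (B (Suc k)) (v (Suc k) + theta \<phi> (Suc k) * (y - v (Suc k)))" for y
    using pq(2) deg[OF pos(2)] by (rule euler_identity_of_derivs) (simp only: pq(4) g)
  \<comment> \<open>Each interval sees only one half of the neighbourhood of either vertex: right of
    \<open>v k\<close>, left of \<open>v (Suc k)\<close>.\<close>
  have Bp: "0 \<le> poly (B k) (v k + theta \<phi> k * (y - v k))" if "y \<in> {v k..\<zeta> k}" for y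
  proof -
    have "left_knot v \<zeta> k \<le> v k"
      using k zeta(2)[of "k - 1"] by (cases k) (auto simp: left_knot_def)
    then show ?thesis
      using B[of k y] that k by (auto simp: right_knot_def)
  qed
  have Bq: "0 \<le> poly (B (Suc k)) (v (Suc k) + theta \<phi> (Suc k) * (y - v (Suc k)))"
    if "y \<in> {\<zeta> k..v (Suc k)}" for y
  proof -
    have "v (Suc k) \<le> right_knot n v \<zeta> (Suc k)"
      using k zeta(1)[of "Suc k"]
      by (cases "Suc k = n") (auto simp: right_knot_def)
    then show ?thesis
      using B[of "Suc k" y] that k by (auto simp: left_knot_def)
  qed
  note nonneg = join_nonneg[OF zeta[OF k(1)] pos p q Bp Bq pq(5), of x]
  have "x \<in> {v k..\<zeta> k} \<or> x \<in> {\<zeta> k..v (Suc k)}"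
    using k by auto
  then show ?thesis
    using nonneg pq by auto
qed

end

theorem lemma5:
  fixes n :: nat and v \<zeta> :: "nat \<Rightarrow> real" and \<phi> :: "nat \<Rightarrow> nat" and a b :: real
  assumes "n \<ge> 1"
    and "a = v 0" and "\<And>i. i < n \<Longrightarrow> v i < v (i + 1)" and "v n = b"
    and "\<And>i. i < n \<Longrightarrow> \<zeta> i \<in> {v i<..<v (i + 1)}"
    and "\<And>i. i \<le> n \<Longrightarrow> \<phi> i \<ge> 2"
  shows "\<forall>i\<le>n. \<forall>\<alpha> :: nat \<times> nat. fst \<alpha> + snd \<alpha> = \<phi> i - 1 \<longrightarrow>
           (\<forall>x\<in>{a..b}. 0 \<le> bspline_like n v \<zeta> \<phi> i \<alpha> x)"
proof -
  interpret refined_partition n v \<zeta> \<phi>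
    by unfold_locales (use assms in auto)
  show ?thesis
    using bspline_like_nonneg assms(2,4) by blast
qed

end
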